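(* Let $G=(V,E)$ be a finite simple graph with $V=\{1,\dots,n\}$, $n\ge1$, and let $c\in\mathbb{R}$. Let $\mathbf{x}\in\mathrm{gKKT}(c)$, set $S=\operatorname{supp}(\mathbf{x})$, and let $\mathcal{G}$ be a group of automorphisms of the induced subgraph $G[S]$. Then there exists a point $\hat{\mathbf{x}}\in\mathrm{gKKT}(c)$ such that $\operatorname{supp}(\hat{\mathbf{x}})=S$ and $\hat{x}_{\sigma(i)}=\hat{x}_i$ for every $i\in S$ and every $\sigma\in\mathcal{G}$.
   Context: Graphs are finite, undirected, unweighted, without loops. $A$ is the adjacency matrix of $G$, $I$ the $n\times n$ identity matrix, $\mathbf 1$ the all-ones vector. $\Delta_n=\{\mathbf{x}\in\mathbb{R}^n:\mathbf{1}^\top\mathbf{x}=1,\ \mathbf{x}\ge\mathbf 0\}$ and $\operatorname{supp}(\mathbf{x})=\{i:x_i\ne0\}$. $\mathrm{gKKT}(c)$ is the set of generalized KKT points of the program $\max_{\mathbf{x}\in\Delta_n}\mathbf{x}^\top(A+cI)\mathbf{x}$: the set of $\mathbf{x}\in\Delta_n$ for which there exist $\mu_0\in\mathbb{R}$ and $\boldsymbol\mu\in\mathbb{R}^n$ with $2(A+cI)\mathbf{x}+\mu_0\mathbf{1}+\boldsymbol\mu=\mathbf 0$ and $\mu_ix_i=0$ for every $i\in V$ (no sign condition on $\boldsymbol\mu$). *)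

theory Defs
  imports "HOL-Analysis.Analysis" "HOL-Algebra.Bij" "Graph_Theory.Digraph_Component"
begin

text \<open>
  Graphs are taken from \<^theory>\<open>Graph_Theory.Digraph\<close>: the locale \<^locale>\<open>Digraph.graph\<close> describes
  finite simple undirected graphs, in which every edge is represented by a pair of opposite arcs.
  Adjacency is \<open>u \<rightarrow>\<^bsub>G\<^esub> v\<close>, and the induced subgraph on \<open>S\<close> is \<open>G \<restriction> S\<close>. The vertex set
  $\{1,\dots,n\}$ is the universe of the index type, of cardinality $n$, of the vectors and matrices.
\<close>

definition adj_matrix :: "('n::finite, 'b) pre_digraph \<Rightarrow> real ^ 'n ^ 'n" where
  "adj_matrix G = (\<chi> i j. if i \<rightarrow>\<^bsub>G\<^esub> j then 1 else 0)"

definition graph_auto :: "('a, 'b) pre_digraph \<Rightarrow> ('a \<Rightarrow> 'a) set" where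
  "graph_auto G =
     {\<sigma> \<in> Bij (verts G). \<forall>u\<in>verts G. \<forall>v\<in>verts G. \<sigma> u \<rightarrow>\<^bsub>G\<^esub> \<sigma> v \<longleftrightarrow> u \<rightarrow>\<^bsub>G\<^esub> v}"

text \<open>As with \<^const>\<open>AutoGroup\<close>, automorphisms are extensional, i.e. \<open>undefined\<close> off the vertex set.\<close>

definition graph_AutGroup :: "('a, 'b) pre_digraph \<Rightarrow> ('a \<Rightarrow> 'a) monoid" where
  "graph_AutGroup G = BijGroup (verts G) \<lparr>carrier := graph_auto G\<rparr>"

lemma subgroup_graph_auto: "subgroup (graph_auto G) (BijGroup (verts G))"
proof (rule subgroup.intro)
  show "graph_auto G \<subseteq> carrier (BijGroup (verts G))"
    by (auto simp: graph_auto_def BijGroup_def)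
next
  fix f g assume fg: "f \<in> graph_auto G" "g \<in> graph_auto G"
  then have "g u \<in> verts G" if "u \<in> verts G" for u
    using that by (auto simp: graph_auto_def dest: Bij_imp_funcset)
  with fg show "f \<otimes>\<^bsub>BijGroup (verts G)\<^esub> g \<in> graph_auto G"
    by (simp add: graph_auto_def BijGroup_def compose_Bij compose_eq)
next
  show "\<one>\<^bsub>BijGroup (verts G)\<^esub> \<in> graph_auto G"
    by (auto simp: graph_auto_def BijGroup_def id_Bij)
next
  fix f assume f: "f \<in> graph_auto G"
  then have b: "f \<in> Bij (verts G)" and im: "f ` verts G = verts G"
    by (auto simp: graph_auto_def Bij_def bij_betw_def)
  have "restrict (inv_into (verts G) f) (verts G) \<in> graph_auto G"
    using f restrict_inv_into_Bij[OF b] Bij_inv_into_mem[OF b]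
    by (auto simp: graph_auto_def) (metis f_inv_into_f im)+
  then show "inv\<^bsub>BijGroup (verts G)\<^esub> f \<in> graph_auto G"
    by (simp add: inv_BijGroup[OF b])
qed

theorem group_graph_AutGroup: "group (graph_AutGroup G)"
  by (simp add: graph_AutGroup_def subgroup.subgroup_is_group subgroup_graph_auto group_BijGroup)

definition std_simplex :: "(real ^ 'n::finite) set" where
  "std_simplex = {x. 1 \<bullet> x = 1 \<and> (\<forall>i. 0 \<le> x $ i)}"

definition supp :: "real ^ 'n::finite \<Rightarrow> 'n set" where
  "supp x = {i. x $ i \<noteq> 0}"

definition gKKT :: "('n::finite, 'b) pre_digraph \<Rightarrow> real \<Rightarrow> (real ^ 'n) set" where
  "gKKT G c =
     {x \<in> std_simplex. \<exists>(\<mu>\<^sub>0::real) (\<mu>::real ^ 'n).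
        2 *\<^sub>R ((adj_matrix G + c *\<^sub>R mat 1) *v x) + \<mu>\<^sub>0 *\<^sub>R 1 + \<mu> = 0 \<and>
        (\<forall>i. \<mu> $ i * x $ i = 0)}"

end

theory Submission
  imports Defs
begin

text \<open>
  On its support, a generalized KKT point \<open>x\<close> solves the linear equations \<open>((A + cI)x)\<^sub>i = l\<close>, in which
  only the adjacencies inside \<open>S = supp x\<close> matter. Precomposing \<open>x\<close> with an automorphism of \<open>G \<restriction> S\<close>
  therefore gives another solution with the same \<open>l\<close> and the same support. Averaging these solutions
  over the group gives an invariant one, and its support is still \<open>S\<close> because every averaged entry is
  positive.
\<close>

lemma sum_supp:
  assumes "supp x = S"
  shows "(\<Sum>j\<in>UNIV. f j * x $ j) = (\<Sum>j\<in>S. f j * x $ j)"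
  by (rule sum.mono_neutral_right) (use assms in \<open>auto simp: supp_def\<close>)

text \<open>Complementarity kills \<open>\<mu>\<close> on \<open>S\<close>, so stationarity there
  makes the gradient constant. Off \<open>S\<close> the entries of \<open>x\<close> vanish and
  \<open>\<mu>\<close> carries no sign condition, so it absorbs any gradient. The zeros of
  \<open>x\<close> also confine all sums to \<open>S\<close>.\<close>

lemma gKKT_iff:
  assumes "supp x = S"
  shows "x \<in> gKKT G c \<longleftrightarrow>
    (\<forall>i. 0 \<le> x $ i) \<and> (\<Sum>i\<in>S. x $ i) = 1 \<and>
    (\<exists>l. \<forall>i\<in>S. (\<Sum>j\<in>S. adj_matrix G $ i $ j * x $ j) + c * x $ i = l)"
proof -
  let ?g = "\<lambda>i. (\<Sum>j\<in>S. adj_matrix G $ i $ j * x $ j) + c * x $ i"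
  have g: "((adj_matrix G + c *\<^sub>R mat 1) *v x) $ i = ?g i" for i
  proof -
    have "((adj_matrix G + c *\<^sub>R mat 1) *v x) $ i = (adj_matrix G *v x) $ i + c * x $ i"
      by (simp add: matrix_vector_mult_add_rdistrib scaleR_matrix_vector_assoc[symmetric])
    then show ?thesis
      by (simp add: matrix_vector_mult_def sum_supp[OF assms])
  qed
  have S: "i \<in> S \<longleftrightarrow> x $ i \<noteq> 0" for i
    using assms by (auto simp: supp_def)
  have simplex: "x \<in> std_simplex \<longleftrightarrow> (\<forall>i. 0 \<le> x $ i) \<and> (\<Sum>i\<in>S. x $ i) = 1"
    using sum_supp[OF assms, of "\<lambda>_. 1"] by (auto simp: std_simplex_def inner_vec_def)
  have "(\<exists>\<mu>\<^sub>0 \<mu>. 2 *\<^sub>R ((adj_matrix G + c *\<^sub>R mat 1) *v x) + \<mu>\<^sub>0 *\<^sub>R 1 + \<mu> = 0 \<and>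
          (\<forall>i. \<mu> $ i * x $ i = 0)) \<longleftrightarrow> (\<exists>l. \<forall>i\<in>S. ?g i = l)" (is "?L \<longleftrightarrow> ?R")
  proof
    assume ?L
    then obtain \<mu>\<^sub>0 \<mu> where eq: "\<And>i. 2 * ?g i + \<mu>\<^sub>0 + \<mu> $ i = 0" and "\<And>i. i \<in> S \<Longrightarrow> \<mu> $ i = 0"
      unfolding vec_eq_iff by (auto simp: g S)
    then have "?g i = - \<mu>\<^sub>0 / 2" if "i \<in> S" for i
      using eq[of i] that by simp
    then show ?R by blast
  next
    assume ?R
    then obtain l where l: "\<And>i. i \<in> S \<Longrightarrow> ?g i = l" by blast
    have "(2 * l - 2 * ?g i) * x $ i = 0" for i
      using l[of i] by (cases "i \<in> S") (simp_all, simp add: S)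
    \<comment> \<open>With \<open>\<mu>\<^sub>0\<close> equal to \<open>- 2 * l\<close>,
      stationarity forces this \<open>\<mu>\<close>.\<close>
    then show ?L
      by (intro exI[of _ "- 2 * l"] exI[of _ "\<chi> i. 2 * l - 2 * ?g i"])
        (simp add: vec_eq_iff g)
  qed
  then show ?thesis by (simp add: gKKT_def simplex)
qed

text \<open>Inside \<open>S\<close>, adjacency in \<open>G \<restriction> S\<close> and in
  \<open>G\<close> coincide, so \<sigma> preserves the block of the adjacency matrix of
  \<open>G\<close> indexed by \<open>S\<close>.\<close>

lemma graph_auto_induce_subgraph:
  assumes "\<sigma> \<in> graph_auto (G \<restriction> S)"
  shows "bij_betw \<sigma> S S"
    and "\<lbrakk>i \<in> S; j \<in> S\<rbrakk> \<Longrightarrow> adj_matrix G $ \<sigma> i $ \<sigma> j = adj_matrix G $ i $ j"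
proof -
  show b: "bij_betw \<sigma> S S"
    using assms by (simp add: graph_auto_def Bij_def)
  have "i \<rightarrow>\<^bsub>G \<restriction> S\<^esub> j \<longleftrightarrow> i \<rightarrow>\<^bsub>G\<^esub> j" if "i \<in> S" "j \<in> S" for i j
    using that by (auto simp: arcs_ends_def arc_to_ends_def induce_subgraph_def)
  then show "adj_matrix G $ \<sigma> i $ \<sigma> j = adj_matrix G $ i $ j" if "i \<in> S" "j \<in> S"
    using assms that bij_betwE[OF b] by (simp add: graph_auto_def adj_matrix_def)
qed

text \<open>Right multiplication by \<tau> permutes \<open>H\<close>, so it only reorders the sum.
  This is what makes the average over the group invariant.\<close>

lemma sum_subgroup_graph_AutGroup_right_translate:
  fixes G :: "('n::finite, 'b) pre_digraph"
  assumes H: "subgroup H (graph_AutGroup (G \<restriction> S))" and "\<tau> \<in> H" and "i \<in> S"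
  shows "(\<Sum>\<sigma>\<in>H. f (\<sigma> (\<tau> i))) = (\<Sum>\<sigma>\<in>H. f (\<sigma> i))"
proof -
  interpret A: group "graph_AutGroup (G \<restriction> S)" by (rule group_graph_AutGroup)
  have sub: "H \<subseteq> carrier (graph_AutGroup (G \<restriction> S))"
    by (rule subgroup.subset[OF H])
  let ?m = "\<lambda>\<sigma>. \<sigma> \<otimes>\<^bsub>graph_AutGroup (G \<restriction> S)\<^esub> \<tau>"
  \<comment> \<open>The group product is composition restricted to \<open>S\<close>, hence the
    evaluation at a point of \<open>S\<close>.\<close>
  have m: "?m \<sigma> i = \<sigma> (\<tau> i)" if "\<sigma> \<in> H" for \<sigma>
    using that sub \<open>\<tau> \<in> H\<close> \<open>i \<in> S\<close>
    by (auto simp: graph_AutGroup_def BijGroup_def graph_auto_def compose_def)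
  have inj: "inj_on ?m H"
  proof (rule inj_onI)
    fix \<sigma> \<rho> assume "\<sigma> \<in> H" "\<rho> \<in> H" "?m \<sigma> = ?m \<rho>"
    then show "\<sigma> = \<rho>"
      using A.right_cancel[of \<tau> \<sigma> \<rho>] sub \<open>\<tau> \<in> H\<close> by blast
  qed
  have "?m ` H \<subseteq> H"
    using subgroup.m_closed[OF H] \<open>\<tau> \<in> H\<close> by auto
  \<comment> \<open>\<open>H\<close> is finite because the type \<open>'n\<close> is, so an
    injective self-map is onto.\<close>
  then have "bij_betw ?m H H"
    using inj by (simp add: bij_betw_def endo_inj_surj)
  then have "(\<Sum>\<sigma>\<in>H. f (\<sigma> i)) = (\<Sum>\<sigma>\<in>H. f (?m \<sigma> i))"
    by (rule sum.reindex_bij_betw[symmetric])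
  then show ?thesis by (simp add: m)
qed

theorem lemma1:
  fixes G :: "('n::finite, 'b) pre_digraph" and c :: real
    and x :: "real ^ 'n" and S :: "'n set" and \<G> :: "('n \<Rightarrow> 'n) set"
  assumes "Digraph.graph G" and "verts G = UNIV"
    and "x \<in> gKKT G c"
    and "S = supp x"
    and "subgroup \<G> (graph_AutGroup (G \<restriction> S))"
  shows "\<exists>x' \<in> gKKT G c. supp x' = S \<and> (\<forall>i\<in>S. \<forall>\<sigma>\<in>\<G>. x' $ \<sigma> i = x' $ i)"
proof -
  obtain l where nonneg: "\<And>i. 0 \<le> x $ i" and sum1: "(\<Sum>i\<in>S. x $ i) = 1"
    and l: "\<And>i. i \<in> S \<Longrightarrow> (\<Sum>j\<in>S. adj_matrix G $ i $ j * x $ j) + c * x $ i = l"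
    using assms(3,4) by (auto simp: gKKT_iff[of x S])
  have pos: "0 < x $ i" if "i \<in> S" for i
    using that nonneg[of i] assms(4) by (auto simp: supp_def)
  have aut: "\<sigma> \<in> graph_auto (G \<restriction> S)" if "\<sigma> \<in> \<G>" for \<sigma>
    using subgroup.subset[OF assms(5)] that by (auto simp: graph_AutGroup_def)
  note bij = graph_auto_induce_subgraph(1)[OF aut]
  note adj = graph_auto_induce_subgraph(2)[OF aut]
  have mem: "\<sigma> i \<in> S" if "\<sigma> \<in> \<G>" "i \<in> S" for \<sigma> i
    using bij[OF that(1)] that(2) by (rule bij_betw_apply)
  define N where "N = real (card \<G>)"
  have "\<G> \<noteq> {}"
    using subgroup.one_closed[OF assms(5)] by auto
  then have N: "N > 0" by (simp add: N_def card_gt_0_iff)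
  \<comment> \<open>Automorphisms are \<open>undefined\<close> off \<open>S\<close>, so the average
    is taken only on \<open>S\<close>; the value 0 elsewhere keeps the support inside
    \<open>S\<close>.\<close>
  define y where "y = (\<chi> i. if i \<in> S then (\<Sum>\<sigma>\<in>\<G>. x $ \<sigma> i) / N else 0)"
  have y: "y $ i = (\<Sum>\<sigma>\<in>\<G>. x $ \<sigma> i) / N" if "i \<in> S" for i
    using that by (simp add: y_def)
  have y_pos: "0 < y $ i" if "i \<in> S" for i
  proof -
    have "0 < (\<Sum>\<sigma>\<in>\<G>. x $ \<sigma> i)"
      using that \<open>\<G> \<noteq> {}\<close> by (intro sum_pos) (simp_all add: pos mem)
    then show ?thesis using that N by (simp add: y)
  qed
  have supp: "supp y = S"
    using y_pos by (force simp: supp_def y_def)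
  have "(\<Sum>i\<in>S. y $ i) = (\<Sum>\<sigma>\<in>\<G>. \<Sum>i\<in>S. x $ \<sigma> i) / N"
    by (simp add: y sum.swap[of _ \<G>] flip: sum_divide_distrib)
  \<comment> \<open>Each \<sigma> permutes \<open>S\<close>, so every inner sum is 1.\<close>
  also have "(\<Sum>\<sigma>\<in>\<G>. \<Sum>i\<in>S. x $ \<sigma> i) = N"
    using sum1 by (simp add: sum.reindex_bij_betw[OF bij] N_def)
  finally have y_sum: "(\<Sum>i\<in>S. y $ i) = 1" using N by simp
  have y_eq: "(\<Sum>j\<in>S. adj_matrix G $ i $ j * y $ j) + c * y $ i = l" if i: "i \<in> S" for i
  proof -
    \<comment> \<open>This is the equation of \<open>x\<close> at the vertex
      \<open>\<sigma> i\<close>, with its sum reindexed along \<sigma>.\<close>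
    have \<sigma>_eq: "(\<Sum>j\<in>S. adj_matrix G $ i $ j * x $ \<sigma> j) + c * x $ \<sigma> i = l" if "\<sigma> \<in> \<G>" for \<sigma>
    proof -
      have "(\<Sum>j\<in>S. adj_matrix G $ i $ j * x $ \<sigma> j)
          = (\<Sum>j\<in>S. adj_matrix G $ \<sigma> i $ \<sigma> j * x $ \<sigma> j)"
        using that i by (simp add: adj)
      also have "\<dots> = (\<Sum>j\<in>S. adj_matrix G $ \<sigma> i $ j * x $ j)"
        by (rule sum.reindex_bij_betw[OF bij[OF that]])
      finally show ?thesis using l[OF mem[OF that i]] by simp
    qed
    \<comment> \<open>By linearity the left side for \<open>y\<close> is the mean of the left sides
      in \<open>\<sigma>_eq\<close>, all equal to \<open>l\<close>.\<close>
    have "(\<Sum>j\<in>S. adj_matrix G $ i $ j * y $ j)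
        = (\<Sum>\<sigma>\<in>\<G>. \<Sum>j\<in>S. adj_matrix G $ i $ j * x $ \<sigma> j) / N"
      by (simp add: y sum.swap[of _ \<G>] sum_distrib_left flip: sum_divide_distrib)
    then have "(\<Sum>j\<in>S. adj_matrix G $ i $ j * y $ j) + c * y $ i
        = (\<Sum>\<sigma>\<in>\<G>. (\<Sum>j\<in>S. adj_matrix G $ i $ j * x $ \<sigma> j) + c * x $ \<sigma> i) / N"
      using i by (simp add: y sum.distrib sum_distrib_left add_divide_distrib)
    also have "\<dots> = l"
      using \<open>\<G> \<noteq> {}\<close> by (simp add: \<sigma>_eq N_def)
    finally show ?thesis .
  qed
  have "0 \<le> y $ i" for i
    using y_pos[of i] by (cases "i \<in> S") (auto simp: y_def)
  then have "y \<in> gKKT G c"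
    using y_sum y_eq by (auto simp: gKKT_iff[OF supp])
  moreover have "y $ \<sigma> i = y $ i" if "i \<in> S" "\<sigma> \<in> \<G>" for i \<sigma>
    using that mem[of \<sigma> i] sum_subgroup_graph_AutGroup_right_translate[OF assms(5), of \<sigma> i "($) x"]
    by (simp add: y)
  ultimately show ?thesis using supp by blast
qed

end
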